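(* Let $n,n'$ be positive integers. If $n\neq n'$, then $V(G(m,n))\cap V(G(m',n'))=\varnothing$ for any positive integers $m,m'$.
   Context: $\mathcal{F}_m=(e^{2\pi i jk/m})_{0\le j,k\le m-1}$ is the $m\times m$ Fourier matrix. For $J,K\subseteq\{0,\ldots,m-1\}$ with $|J|=|K|=n$, $H_{J,K}=H_{J,K,m}=(e^{2\pi i jk/m})_{j\in J,k\in K}$ is the $n\times n$ submatrix of $\mathcal{F}_m$ with rows $J$ and columns $K$ (each listed in increasing order). An $n\times n$ complex matrix $H$ is Hadamard if all its entries have modulus $1$ and $H^*H=HH^*=nI_n$. For a nonempty finite set $X$ of nonnegative integers, $\mathcal{D}(X)=\{x_1-x_2:x_1,x_2\in X\}$ and $\mathcal{P}_m(X)=\left\{\frac{m}{\gcd(m,d)}:d\in\mathcal{D}(X)\right\}$ (with $\gcd(m,0)=m$). The compatibility graph $G(m,n)$ is the undirected graph (loops allowed) with vertex set $V(G(m,n))=\{\mathcal{P}_m(J): J,K\subseteq\{0,\ldots,m-1\},\ H_{J,K}\text{ is an }n\times n\text{ Hadamard submatrix of }\mathcal{F}_m\}$ and edge set consisting of all $\{\mathcal{P}_m(J),\mathcal{P}_m(K)\}$ such that $H_{J,K}$ is an $n\times n$ Hadamard submatrix of $\mathcal{F}_m$; it is empty if there are no such submatrices. *)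

theory Defs
  imports
    Complex_Main
    "Jordan_Normal_Form.Schur_Decomposition"
    "Jordan_Normal_Form.DL_Submatrix"
begin

definition fourier_mat :: "nat \<Rightarrow> complex mat" where
  "fourier_mat m =
     mat m m (\<lambda>(j, k). exp (2 * of_real pi * \<i> * of_nat j * of_nat k / of_nat m))"

(* submatrix lists the selected rows and columns in increasing order
   and ignores indices outside the range of the matrix. *)
definition fourier_submat :: "nat \<Rightarrow> nat set \<Rightarrow> nat set \<Rightarrow> complex mat" where
  "fourier_submat m J K = submatrix (fourier_mat m) J K"

definition hadamard_mat :: "nat \<Rightarrow> complex mat \<Rightarrow> bool" where
  "hadamard_mat n H \<longleftrightarrow>
     H \<in> carrier_mat n n \<and>
     (\<forall>i<n. \<forall>j<n. cmod (H $$ (i, j)) = 1) \<and>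
     mat_adjoint H * H = of_nat n \<cdot>\<^sub>m 1\<^sub>m n \<and>
     H * mat_adjoint H = of_nat n \<cdot>\<^sub>m 1\<^sub>m n"

definition hadamard_pair :: "nat \<Rightarrow> nat \<Rightarrow> nat set \<Rightarrow> nat set \<Rightarrow> bool" where
  "hadamard_pair m n J K \<longleftrightarrow>
     J \<subseteq> {0..<m} \<and> K \<subseteq> {0..<m} \<and> card J = n \<and> card K = n \<and>
     hadamard_mat n (fourier_submat m J K)"

definition diff_set :: "nat set \<Rightarrow> int set" where
  "diff_set X = {int x1 - int x2 | x1 x2. x1 \<in> X \<and> x2 \<in> X}"

(* The division is exact. *)
definition period_set :: "nat \<Rightarrow> nat set \<Rightarrow> int set" where
  "period_set m X = {int m div gcd (int m) d | d. d \<in> diff_set X}"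

(* Undirected graphs with loops: an edge is a set of one or two vertices,
   a singleton being a loop. *)
record 'a loop_graph =
  vertices :: "'a set"
  edges :: "'a set set"

definition compat_graph :: "nat \<Rightarrow> nat \<Rightarrow> int set loop_graph" where
  "compat_graph m n =
     \<lparr> vertices = {period_set m J | J K. hadamard_pair m n J K},
       edges = {{period_set m J, period_set m K} | J K. hadamard_pair m n J K} \<rparr>"

end

theory Submission
  imports Defs "HOL-Number_Theory.Cong"
begin

text \<open>For \<open>K \<subseteq> {0..<m}\<close> let \<open>f\<^sub>K = \<Sum>k\<in>K. x ^ k\<close>, an integer polynomial. Orthogonality
  of the rows \<open>i\<close> and \<open>j\<close> of a Hadamard submatrix with columns \<open>K\<close> says that \<open>f\<^sub>K\<close>
  vanishes at \<open>exp (2 \<pi> \<i> (i - j) / m)\<close>. This number is a primitive root of unity of order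
  \<open>m / gcd m (i - j)\<close>, and all primitive roots of unity of one order are conjugate. So whether
  \<open>f\<^sub>K\<close> vanishes there depends only on that order: if \<open>(J', K')\<close> is a Hadamard pair for \<open>m'\<close>,
  then \<open>f\<^sub>K\<^sub>'\<close> vanishes at every root of unity whose order is an element other than 1 of the
  period set of \<open>J'\<close>.

  Suppose now that \<open>(J, K)\<close> for \<open>m\<close> and \<open>(J', K')\<close> for \<open>m'\<close> have the same period
  set on the row side. Combine the rows of the first pair with the columns of the second: the
  previous paragraph says that the rows of the matrix
  \<open>exp (2 \<pi> \<i> j k / m)\<close> with \<open>j \<in> J\<close> and \<open>k \<in> K'\<close> are pairwise orthogonal. They are
  nonzero vectors of length \<open>card K'\<close>, whence \<open>card J \<le> card K'\<close>
  (\<open>hadamard_pair_card_le_if_period_set_eq\<close>). By symmetry the two sizes agree.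

  The arithmetic input is \<open>integer_poly_root_power_coprime\<close>, which expresses the irreducibility
  of cyclotomic polynomials as a statement about zeros: the zeros of an integer polynomial that are
  roots of unity of order dividing \<open>s\<close> are permuted by powers coprime to \<open>s\<close>. For a
  prime exponent this is Dedekind's argument with the Frobenius map modulo \<open>p\<close>.\<close>

section \<open>Polynomial congruences modulo a prime\<close>

text \<open>The ring itself need not have characteristic \<open>p\<close>; divisibility by \<open>of_nat p\<close> keeps
  the Frobenius congruence in a form that can later be evaluated at a complex number.\<close>

lemma prime_dvd_power_add_diff:
  fixes x y :: "'a::comm_ring_1"
  assumes "prime (p::nat)"
  shows "of_nat p dvd (x + y) ^ p - (x ^ p + y ^ p)"
proof -
  have p0: "p > 0" using assms prime_gt_0_nat by blast
  have "(x + y) ^ p = (\<Sum>k\<le>p. of_nat (p choose k) * x ^ k * y ^ (p - k))"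
    by (rule binomial_ring)
  also have "\<dots> = (\<Sum>k\<in>{0,p}. of_nat (p choose k) * x ^ k * y ^ (p - k))
      + (\<Sum>k\<in>{..p} - {0,p}. of_nat (p choose k) * x ^ k * y ^ (p - k))"
    by (subst sum.subset_diff[of "{0,p}" "{..p}"]) (auto simp: add.commute)
  finally have eq: "(x + y) ^ p - (x ^ p + y ^ p)
      = (\<Sum>k\<in>{..p} - {0,p}. of_nat (p choose k) * x ^ k * y ^ (p - k))"
    using p0 by (simp add: algebra_simps)
  have "of_nat p dvd (of_nat (p choose k) :: 'a)" if "k \<in> {..p} - {0,p}" for k
    proof -
    have "p dvd p choose k" using that assms p0 by (intro dvd_choose_prime) auto
    then obtain c where "p choose k = p * c" by blast
    then show ?thesis by simp
  qed
  then show ?thesis unfolding eq by (intro dvd_sum dvd_mult2) auto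
qed

text \<open>Fermat's little theorem for all integers, by stepping from \<open>a\<close> to \<open>a \<plusminus> 1\<close> with
  the congruence above.\<close>

lemma prime_dvd_power_diff_int:
  fixes a :: int
  assumes p: "prime (p::nat)"
  shows "of_nat p dvd a ^ p - a"
proof (induction a rule: int_induct[of _ 0])
  case base
  then show ?case using p prime_gt_0_nat by (simp add: zero_power)
next
  case (step1 i)
  then show ?case
    using dvd_add[OF prime_dvd_power_add_diff[OF p, of i 1] step1(2)] by (simp add: algebra_simps)
next
  case (step2 i)
  show ?case
    using dvd_diff[OF step2(2) prime_dvd_power_add_diff[OF p, of "i - 1" 1]]
    by (simp add: algebra_simps)
qed

text \<open>Raising to the power \<open>p\<close> is additive and multiplicative modulo \<open>p\<close>, fixes integer
  constants by Fermat, and sends \<open>x\<close> to \<open>x ^ p\<close>. It is therefore the substitution of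
  \<open>x ^ p\<close> for \<open>x\<close>.\<close>

lemma prime_dvd_power_diff_pcompose:
  fixes f :: "int poly"
  assumes p: "prime (p::nat)"
  shows "of_nat p dvd f ^ p - pcompose f (monom 1 p)"
proof (induction f)
  case 0
  then show ?case using p prime_gt_0_nat by (simp add: zero_power)
next
  case (pCons a f)
  let ?x = "[:0, 1:] :: int poly" and ?X = "monom 1 p :: int poly"
  have split: "pCons a f = [:a:] + ?x * f"
    by simp
  have X: "?x ^ p = ?X" by (simp add: monom_altdef)
  have 1: "of_nat p dvd (pCons a f) ^ p - ([:a:] ^ p + (?x * f) ^ p)"
    unfolding split by (rule prime_dvd_power_add_diff[OF p])
  have "[:int p:] dvd [:a ^ p - a:]"
    using prime_dvd_power_diff_int[OF p, of a] by (simp add: const_poly_dvd)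
  then have 2: "of_nat p dvd [:a:] ^ p - [:a:]"
    by (simp add: of_nat_poly poly_const_pow)
  have 3: "of_nat p dvd ?X * (f ^ p - pcompose f ?X)"
    using pCons.IH by (rule dvd_mult)
  have "(pCons a f) ^ p - pcompose (pCons a f) ?X
      = ((pCons a f) ^ p - ([:a:] ^ p + (?x * f) ^ p)) + ([:a:] ^ p - [:a:])
        + ?X * (f ^ p - pcompose f ?X)"
    by (simp only: pcompose_pCons power_mult_distrib X) (simp only: algebra_simps)
  then show ?case using dvd_add[OF dvd_add[OF 1 2] 3] by (simp only:)
qed

section \<open>Conjugate roots of unity\<close>

abbreviation ipoly :: "int poly \<Rightarrow> complex \<Rightarrow> complex" where
  "ipoly f \<equiv> poly (map_poly of_int f)"

lemma ipoly_simps: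
  "ipoly 0 z = 0"
  "ipoly 1 z = 1"
  "ipoly (f + g) z = ipoly f z + ipoly g z"
  "ipoly (f - g) z = ipoly f z - ipoly g z"
  "ipoly (- f) z = - ipoly f z"
  "ipoly (f * g) z = ipoly f z * ipoly g z"
  "ipoly (f ^ n) z = ipoly f z ^ n"
  "ipoly (of_nat n) z = of_nat n"
  "ipoly [:c:] z = of_int c"
  "ipoly (smult c f) z = of_int c * ipoly f z"
  "ipoly (monom c n) z = of_int c * z ^ n"
  "ipoly (pcompose f g) z = ipoly f (ipoly g z)"
  "ipoly (sum F A) z = (\<Sum>a\<in>A. ipoly (F a) z)"
  by (simp_all add: of_int_hom.map_poly_pcompose poly_pcompose poly_monom poly_sum hom_distribs)

text \<open>A nonzero integer polynomial of least degree vanishing at \<open>z\<close> divides, up to an integer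
  factor, every other one; by Gauss's lemma its primitive part divides them over the integers.\<close>

lemma primitive_integer_minimal_polynomial:
  fixes z :: complex
  assumes "f0 \<noteq> 0" and "ipoly f0 z = 0"
  obtains g :: "int poly" where "ipoly g z = 0"
    and "\<And>f. ipoly f z = 0 \<Longrightarrow> g dvd f"
proof -
  define P where "P g \<longleftrightarrow> g \<noteq> 0 \<and> ipoly g z = 0" for g :: "int poly"
  define g0 where "g0 = arg_min degree P"
  have "P f0" using assms by (simp add: P_def)
  then have g0: "P g0" and min: "\<And>f. P f \<Longrightarrow> degree g0 \<le> degree f"
    unfolding g0_def by (auto intro: arg_min_natI arg_min_nat_le)
  have g0_nz: "g0 \<noteq> 0" and g0_z: "ipoly g0 z = 0"
    using g0 by (auto simp: P_def)
  show thesis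
  proof
    have "ipoly (smult (content g0) (primitive_part g0)) z = 0"
      using g0_z by simp
    then have "of_int (content g0) * ipoly (primitive_part g0) z = 0"
      by (simp only: ipoly_simps poly_smult)
    then show "ipoly (primitive_part g0) z = 0" using g0_nz by simp
  next
    fix f :: "int poly" assume f: "ipoly f z = 0"
    obtain a q where a: "a \<noteq> 0" and eq: "smult a f = g0 * q + pseudo_mod f g0"
      using pseudo_mod(1)[OF g0_nz] by blast
    have "pseudo_mod f g0 = smult a f - g0 * q" using eq by simp
    then have "ipoly (pseudo_mod f g0) z = 0"
      using f g0_z by (simp add: ipoly_simps)
    then have "pseudo_mod f g0 = 0"
      using pseudo_mod(2)[OF g0_nz, of f] min[of "pseudo_mod f g0"] by (force simp: P_def)
    then have "g0 dvd smult a f" using eq by simp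
    then obtain q where "smult a f = g0 * q" by blast
    \<comment> \<open>Gauss's lemma: primitive parts are multiplicative, so the integer factor disappears up to sign.\<close>
    then have "smult (sgn a) (primitive_part f) = primitive_part g0 * primitive_part q"
      using primitive_part_mult[of g0 q] by (metis primitive_part_smult unit_factor_int_def)
    moreover have "primitive_part f = smult (sgn a) (smult (sgn a) (primitive_part f))"
      using a by (simp add: sgn_if)
    ultimately have "primitive_part g0 dvd primitive_part f"
      by (metis dvd_smult dvd_triv_left)
    then show "primitive_part g0 dvd f"
      by (metis content_times_primitive_part dvd_smult)
  qed
qed

text \<open>The powers of \<open>z\<close> below the degree of \<open>g\<close> form a basis of \<open>\<int>[z]\<close>, since \<open>g\<close>
  has a unit as leading coefficient. Comparing the coordinates at \<open>1\<close> in \<open>s = p * T(z)\<close>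
  shows that divisibility of integers in \<open>\<int>[z]\<close> is divisibility in \<open>\<int>\<close>.\<close>

lemma prime_dvd_if_multiple_in_adjoined_root:
  fixes z :: complex and g T :: "int poly" and s p :: nat
  assumes g_z: "ipoly g z = 0"
    and g_min: "\<And>f. ipoly f z = 0 \<Longrightarrow> g dvd f"
    and g_lead: "is_unit (lead_coeff g)"
    and T: "of_nat s = of_nat p * ipoly T z"
  shows "p dvd s"
proof -
  have g_nz: "g \<noteq> 0" using g_lead by auto
  have g_deg: "degree g > 0"
  proof (rule ccontr)
    assume "\<not> degree g > 0"
    then obtain c where "g = [:c:]" by (auto elim: degree_eq_zeroE)
    then show False using g_z g_nz by simp
  qed
  \<comment> \<open>Pseudo-division by g is division up to the unit u; r holds the coordinates of u * T(z).\<close>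
  obtain q r where qr: "pseudo_divmod T g = (q, r)" by force
  define u where "u = lead_coeff g ^ (Suc (degree T) - degree g)"
  have u: "is_unit u" unfolding u_def using g_lead by (rule is_unit_power_iff[THEN iffD2, OF disjI1])
  have div: "smult u T = g * q + r" and r: "r = 0 \<or> degree r < degree g"
    using pseudo_divmod[OF g_nz qr] by (auto simp: u_def)
  have "ipoly (smult u T) z = ipoly (g * q + r) z"
    by (simp only: div)
  then have uT: "of_int u * ipoly T z = ipoly r z"
    using g_z by (simp add: ipoly_simps)
  define e where "e = [:u * int s:] - smult (int p) r"
  have "ipoly e z = of_int u * of_nat s - of_nat p * ipoly r z"
    by (simp add: e_def ipoly_simps)
  also have "\<dots> = 0" unfolding T uT[symmetric] by simp
  finally have dvd: "g dvd e" by (rule g_min)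
  have "degree r < degree g" using r g_deg by auto
  then have "degree e < degree g"
    unfolding e_def using g_deg by (intro degree_diff_less) (auto intro: le_less_trans[OF degree_smult_le])
  then have "e = 0" using dvd_imp_degree_le[OF dvd] by (meson leD)
  then have "coeff e 0 = 0" by simp
  then have "u * int s = int p * coeff r 0" by (simp add: e_def)
  then have "int p dvd u * int s" by simp
  then have "int p dvd int s" using u by (simp only: dvd_mult_unit_iff')
  then show ?thesis by simp
qed

text \<open>Let \<open>g\<close> be the minimal polynomial of \<open>z\<close>, write \<open>x ^ s - 1 = g * h\<close>, and let
  \<open>w = z ^ p\<close>. If \<open>g\<close> did not vanish at \<open>w\<close>, then \<open>h\<close> would, and
  differentiation gives \<open>s * w ^ (s - 1) = g(w) * h'(w)\<close>. The Frobenius congruence makes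
  \<open>g(w)\<close> congruent to \<open>g(z) ^ p = 0\<close> modulo \<open>p\<close> in \<open>\<int>[z]\<close>. As \<open>w\<close>
  is a unit, \<open>p\<close> would divide \<open>s\<close>.\<close>

lemma integer_poly_root_power_prime:
  fixes z :: complex and f :: "int poly" and s p :: nat
  assumes s: "s > 0" and z: "z ^ s = 1" and p: "prime p" and ps: "\<not> p dvd s"
    and f: "ipoly f z = 0"
  shows "ipoly f (z ^ p) = 0"
proof -
  define F :: "int poly" where "F = monom 1 s - 1"
  have F_eval: "ipoly F x = x ^ s - 1" for x :: complex
    by (simp add: F_def ipoly_simps poly_monom)
  have F_lead: "lead_coeff F = 1"
  proof -
    have "degree (monom 1 s - 1 :: int poly) = s"
      using s degree_add_eq_left[of "- 1" "monom 1 s :: int poly"] by (simp add: degree_monom_eq)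
    then show ?thesis unfolding F_def using s by (simp add: coeff_1)
  qed
  then have "F \<noteq> 0" by auto
  moreover have F_z: "ipoly F z = 0" using z F_eval by simp
  ultimately obtain g where g_z: "ipoly g z = 0"
    and g_min: "\<And>f. ipoly f z = 0 \<Longrightarrow> g dvd f"
    by (rule primitive_integer_minimal_polynomial) blast
  obtain h where h: "F = g * h" using g_min[OF F_z] by blast
  have g_lead: "is_unit (lead_coeff g)"
    using F_lead unfolding h lead_coeff_mult by (metis dvd_triv_left)
  define w where "w = z ^ p"
  have w: "w ^ s = 1" using z unfolding w_def by (metis mult.commute power_mult power_one)
  have "ipoly g w = 0"
  proof (rule ccontr)
    assume g_w: "ipoly g w \<noteq> 0"
    have "ipoly g w * ipoly h w = 0"
      using F_eval[of w] w unfolding h by (simp add: ipoly_simps)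
    then have h_w: "ipoly h w = 0" using g_w by simp
    have "ipoly (pderiv F) w = ipoly g w * ipoly (pderiv h) w"
      using h_w unfolding h by (simp add: pderiv_mult ipoly_simps)
    moreover have "ipoly (pderiv F) w = of_nat s * w ^ (s - 1)"
      by (simp add: F_def pderiv_diff pderiv_monom ipoly_simps poly_monom)
    ultimately have "of_nat s * (w ^ (s - 1) * w) = ipoly g w * ipoly (pderiv h) w * w"
      by simp
    moreover have "w ^ (s - 1) * w = 1" using w s by (simp only: power_minus_mult)
    ultimately have s_eq: "of_nat s = ipoly g w * ipoly (pderiv h) w * w"
      by (simp only: mult_1_right)
    have comp: "ipoly (pcompose k (monom 1 p)) z = ipoly k w" for k
      by (simp only: ipoly_simps w_def of_int_1 mult_1_left)
    obtain r where r: "g ^ p - pcompose g (monom 1 p) = of_nat p * r"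
      using prime_dvd_power_diff_pcompose[OF p, of g] by blast
    have "ipoly (pcompose g (monom 1 p)) z = ipoly (g ^ p - of_nat p * r) z"
      by (simp only: r[symmetric] diff_diff_eq2 add_diff_cancel_left')
    also have "\<dots> = - of_nat p * ipoly r z"
      unfolding ipoly_simps using g_z prime_gt_0_nat[OF p] by simp
    finally have g_w_eq: "ipoly g w = - of_nat p * ipoly r z"
      by (simp only: comp)
    \<comment> \<open>T expresses g(w) h'(w) w / p as a polynomial in z.\<close>
    define T where "T = - (r * pcompose (pderiv h) (monom 1 p) * monom 1 p)"
    have "of_nat p * ipoly T z
        = - of_nat p * ipoly r z * ipoly (pderiv h) w * w"
      unfolding T_def ipoly_simps(5,6) comp by (simp only: ipoly_simps w_def) simp
    then have "of_nat s = of_nat p * ipoly T z"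
      unfolding s_eq g_w_eq by simp
    with g_z g_min g_lead have "p dvd s" by (rule prime_dvd_if_multiple_in_adjoined_root)
    then show False using ps by simp
  qed
  moreover have "g dvd f" using g_min f by blast
  ultimately show ?thesis unfolding w_def[symmetric] by (auto simp: ipoly_simps elim!: dvdE)
qed

lemma integer_poly_root_power_coprime:
  fixes z :: complex and f :: "int poly" and s a :: nat
  assumes "s > 0" and "z ^ s = 1" and "coprime a s" and "ipoly f z = 0"
  shows "ipoly f (z ^ a) = 0"
  using assms(2-)
proof (induction a arbitrary: z rule: prime_divisors_induct)
  case zero
  then show ?case by simp
next
  case (unit x)
  then show ?case by simp
next
  case (factor p x)
  have "\<not> p dvd s" using factor.hyps factor.prems(2)
    by (meson coprime_common_divisor dvd_triv_left not_prime_unit)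
  then have "ipoly f (z ^ p) = 0"
    using integer_poly_root_power_prime assms(1) factor by blast
  moreover have "(z ^ p) ^ s = 1"
    using factor.prems(1) by (metis mult.commute power_mult power_one)
  ultimately have "ipoly f ((z ^ p) ^ x) = 0"
    using factor by simp
  then show ?case by (simp add: power_mult)
qed

text \<open>Reducing the fraction \<open>d / m\<close> exhibits \<open>s\<close>, the element of the period set that
  \<open>d\<close> contributes, as the order of the root of unity \<open>exp (2 \<pi> \<i> d / m)\<close>.\<close>

lemma cis_reduce_fraction:
  fixes m :: nat and d :: int
  assumes "m > 0"
  defines "s \<equiv> int m div gcd (int m) d"
  obtains b where "s > 0" and "coprime b s"
    and "cis (2 * pi * of_int d / of_nat m) = cis (2 * pi * of_int b / of_int s)"
proof -
  let ?g = "gcd (int m) d"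
  have g: "?g > 0" using assms by simp
  have m: "int m = ?g * s" unfolding s_def by simp
  define b where "b = d div ?g"
  have d: "d = ?g * b" by (simp add: b_def)
  have "s > 0" using m g assms by (metis of_nat_0_less_iff zero_less_mult_pos)
  moreover have "coprime b s"
    unfolding s_def b_def using assms div_gcd_coprime[of "int m" d]
    by (simp add: coprime_commute)
  moreover have "real_of_int d / real m = of_int b / of_int s"
  proof -
    have "real_of_int d / of_int (int m) = of_int (?g * b) / of_int (?g * s)"
      using m d by metis
    also have "\<dots> = of_int b / of_int s"
      unfolding of_int_mult by (rule mult_divide_mult_cancel_left) (use g in linarith)
    finally show ?thesis by simp
  qed
  ultimately show thesis using that[of b]
    by (metis times_divide_eq_right)
qed

text \<open>With both fractions reduced to the common denominator \<open>s\<close>, one root of unity is the power of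
  the other with exponent \<open>b / b'\<close>, computed modulo \<open>s\<close> and coprime to \<open>s\<close>.\<close>

lemma roots_of_unity_same_order_conjugate:
  fixes m m' :: nat and d d' :: int and f :: "int poly"
  assumes m: "m > 0" "m' > 0"
    and eq: "int m div gcd (int m) d = int m' div gcd (int m') d'"
    and f: "ipoly f (cis (2 * pi * of_int d' / of_nat m')) = 0"
  shows "ipoly f (cis (2 * pi * of_int d / of_nat m)) = 0"
proof -
  define s where "s = int m div gcd (int m) d"
  obtain b where s: "s > 0" and b: "coprime b s"
    and cb: "cis (2 * pi * of_int d / of_nat m) = cis (2 * pi * of_int b / of_int s)"
    unfolding s_def using cis_reduce_fraction[OF m(1), of d] by blast
  obtain b' where b': "coprime b' s"
    and cb': "cis (2 * pi * of_int d' / of_nat m') = cis (2 * pi * of_int b' / of_int s)"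
    unfolding s_def eq using cis_reduce_fraction[OF m(2), of d'] by blast
  obtain x where x: "[b' * x = 1] (mod s)" using cong_solve_coprime_int[OF b'] by blast
  have "coprime x s"
    using x by (metis cong_imp_coprime cong_sym coprime_1_left coprime_mult_left_iff)
  then have bx: "coprime (b * x) s" using b by simp
  define a where "a = nat ((b * x) mod s)"
  have a: "int a = (b * x) mod s" using s by (simp add: a_def)
  have "coprime (int a) s" unfolding a using bx s by (simp add: coprime_mod_left_iff)
  then have cop: "coprime a (nat s)" using s by (metis coprime_int_iff int_nat_eq less_le)
  have "[int a * b' = b] (mod s)"
  proof -
    have "[int a * b' = b * x * b'] (mod s)" unfolding a by (intro cong_mult) auto
    also have "b * x * b' = b * (b' * x)" by simp
    also have "[b * (b' * x) = b * 1] (mod s)" using x by (intro cong_mult) auto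
    finally show ?thesis by simp
  qed
  then obtain k where k: "int a * b' = b + s * k"
    by (metis cong_iff_lin cong_sym)
  let ?z = "cis (2 * pi * of_int b' / of_int s)"
  have "real a * (2 * pi * of_int b' / of_int s) = 2 * pi * of_int (int a * b') / of_int s"
    by simp
  also have "\<dots> = 2 * pi * of_int b / of_int s + 2 * pi * of_int k"
    unfolding k using s by (simp add: field_simps)
  finally have "?z ^ a = cis (2 * pi * of_int b / of_int s + 2 * pi * of_int k)"
    by (simp only: DeMoivre)
  also have "\<dots> = cis (2 * pi * of_int b / of_int s)"
    by (simp add: cis_mult[symmetric] cis_multiple_2pi)
  finally have pow: "?z ^ a = cis (2 * pi * of_int d / of_nat m)" using cb by simp
  have "real (nat s) * (2 * pi * of_int b' / of_int s) = 2 * pi * of_int b'"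
    using s by simp
  then have "?z ^ nat s = 1" by (simp only: DeMoivre) (simp add: cis_multiple_2pi)
  from integer_poly_root_power_coprime[OF _ this cop] s f show ?thesis
    unfolding pow[symmetric] cb' by simp
qed

section \<open>Orthogonal unimodular rows\<close>

text \<open>Bessel's inequality for one standard basis vector. All rows \<open>v j\<close> have squared norm
  \<open>card K\<close>, so \<open>w\<close>, which is \<open>card K\<close> times the projection of the \<open>l\<close>-th basis vector
  onto their span, has squared norm \<open>card K * card J\<close>. Its own \<open>l\<close>-th entry is \<open>card J\<close>,
  and \<open>(card J)\<^sup>2 \<le> card K * card J\<close> remains.\<close>

lemma card_orthogonal_unimodular_rows_le:
  fixes v :: "'a \<Rightarrow> 'b \<Rightarrow> complex"
  assumes fin: "finite J" "finite K" and ne: "K \<noteq> {}"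
    and unit: "\<And>j k. j \<in> J \<Longrightarrow> k \<in> K \<Longrightarrow> cmod (v j k) = 1"
    and orth: "\<And>i j. i \<in> J \<Longrightarrow> j \<in> J \<Longrightarrow> i \<noteq> j \<Longrightarrow> (\<Sum>k\<in>K. v i k * cnj (v j k)) = 0"
  shows "card J \<le> card K"
proof -
  obtain l where l: "l \<in> K" using ne by blast
  define N where "N = complex_of_nat (card K)"
  have N: "N \<noteq> 0" "cnj N = N" using fin ne by (auto simp: N_def)
  define w where "w k = (\<Sum>j\<in>J. cnj (v j l) * v j k)" for k
  have one: "v j k * cnj (v j k) = 1" if "j \<in> J" "k \<in> K" for j k
    using unit[OF that] by (simp add: complex_norm_square[symmetric])
  have wl: "w l = of_nat (card J)"
    using one[OF _ l] by (simp add: w_def mult.commute)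
  have "(\<Sum>k\<in>K. w k * cnj (w k))
      = (\<Sum>k\<in>K. \<Sum>i\<in>J. \<Sum>j\<in>J. cnj (v i l) * v j l * (v i k * cnj (v j k)))"
    unfolding w_def by (simp add: sum_product mult_ac)
  also have "\<dots> = (\<Sum>i\<in>J. \<Sum>j\<in>J. cnj (v i l) * v j l * (\<Sum>k\<in>K. v i k * cnj (v j k)))"
    by (subst sum.swap, rule sum.cong[OF refl], subst sum.swap) (simp add: sum_distrib_left)
  also have "\<dots> = (\<Sum>i\<in>J. \<Sum>j\<in>J. if j = i then N else 0)"
  proof (intro sum.cong refl)
    fix i j assume ij: "i \<in> J" "j \<in> J"
    show "cnj (v i l) * v j l * (\<Sum>k\<in>K. v i k * cnj (v j k)) = (if j = i then N else 0)"
      using orth[OF ij] one[OF ij(1)] l ij by (auto simp: N_def mult.commute)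
  qed
  also have "\<dots> = N * of_nat (card J)" using fin by simp
  finally have norm_w: "(\<Sum>k\<in>K. w k * cnj (w k)) = N * of_nat (card J)" .
  have "complex_of_real (\<Sum>k\<in>K. (cmod (w k))\<^sup>2) = of_real (card K * card J)"
    using norm_w by (simp add: complex_norm_square N_def flip: of_real_power)
  then have "(\<Sum>k\<in>K. (cmod (w k))\<^sup>2) = card K * card J"
    by (simp only: of_real_eq_iff)
  moreover have "(cmod (w l))\<^sup>2 \<le> (\<Sum>k\<in>K. (cmod (w k))\<^sup>2)"
    using l fin by (intro member_le_sum) auto
  ultimately have "real (card J * card J) \<le> real (card K * card J)"
    using wl by (simp add: power2_eq_square)
  then have "card J * card J \<le> card K * card J" by (simp only: of_nat_le_iff)
  then show ?thesis by (cases "card J = 0") auto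
qed

section \<open>Hadamard submatrices as vanishing sums\<close>

lemma bij_betw_pick:
  assumes "finite S"
  shows "bij_betw (pick S) {..<card S} S"
proof -
  have "inj_on (pick S) {..<card S}"
    by (rule linorder_inj_onI) (use pick_mono_le in fastforce)+
  moreover have "pick S ` {..<card S} \<subseteq> S" using pick_in_set_le by auto
  moreover have "card (pick S ` {..<card S}) = card S"
    using calculation(1) by (simp add: card_image)
  ultimately show ?thesis
    using assms by (simp add: bij_betw_def card_subset_eq)
qed

lemma fourier_mat_index:
  assumes "j < m" and "k < m"
  shows "fourier_mat m $$ (j, k) = cis (2 * pi * of_nat j / of_nat m) ^ k"
  using assms unfolding fourier_mat_def DeMoivre
  by (simp add: cis_conv_exp algebra_simps)

definition mask_poly :: "nat set \<Rightarrow> int poly" where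
  "mask_poly K = (\<Sum>k\<in>K. monom 1 k)"

lemma poly_mask_poly:
  "ipoly (mask_poly K) z = (\<Sum>k\<in>K. z ^ k)"
  by (simp add: mask_poly_def ipoly_simps poly_monom del: map_poly_monom)

lemma cis_power_mult_cnj:
  "cis x ^ k * cnj (cis y ^ k) = cis (x - y) ^ k"
  by (simp add: cis_cnj power_mult_distrib[symmetric] cis_mult)

lemma hadamard_pair_mask_poly_eq_0:
  assumes H: "hadamard_pair m n J K"
    and i: "i \<in> J" and j: "j \<in> J" and ij: "i \<noteq> j"
  shows "ipoly (mask_poly K) (cis (2 * pi * of_int (int i - int j) / of_nat m)) = 0"
proof -
  have J: "J \<subseteq> {0..<m}" "card J = n" and K: "K \<subseteq> {0..<m}" "card K = n"
    and had: "hadamard_mat n (fourier_submat m J K)"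
    using H by (auto simp: hadamard_pair_def)
  have fin: "finite J" "finite K" using J K finite_subset by blast+
  let ?H = "fourier_submat m J K"
  have cJ: "{x. x < m \<and> x \<in> J} = J" and cK: "{x. x < m \<and> x \<in> K} = K" using J K by auto
  have bJ: "bij_betw (pick J) {..<n} J" and bK: "bij_betw (pick K) {..<n} K"
    using bij_betw_pick fin J K by metis+
  obtain a where a: "a < n" "pick J a = i" using bJ i unfolding bij_betw_def by (metis imageE lessThan_iff)
  obtain b where b: "b < n" "pick J b = j" using bJ j unfolding bij_betw_def by (metis imageE lessThan_iff)
  have dims: "?H \<in> carrier_mat n n" using had by (simp add: hadamard_mat_def)
  have entry: "?H $$ (c, l) = cis (2 * pi * of_nat (pick J c) / of_nat m) ^ pick K l"
    if "c < n" "l < n" for c l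
  proof -
    have "pick J c \<in> J" "pick K l \<in> K"
      using bJ bK that by (auto simp: bij_betw_def)
    then have "pick J c < m" "pick K l < m" using J K by auto
    moreover have "?H $$ (c, l) = fourier_mat m $$ (pick J c, pick K l)"
      unfolding fourier_submat_def using that J K
      by (intro submatrix_index) (auto simp: fourier_mat_def cJ cK)
    ultimately show ?thesis by (simp add: fourier_mat_index)
  qed
  have "(?H * mat_adjoint ?H) $$ (a, b) = (\<Sum>l<n. ?H $$ (a, l) * cnj (?H $$ (b, l)))"
    using dims a b
    by (auto simp: mat_adjoint_def scalar_prod_def mat_of_rows_def lessThan_atLeast0)
  moreover have "(?H * mat_adjoint ?H) $$ (a, b) = 0"
    using had a b ij by (auto simp: hadamard_mat_def)
  ultimately have "0 = (\<Sum>l<n. ?H $$ (a, l) * cnj (?H $$ (b, l)))" by simp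
  also have "\<dots> = (\<Sum>l<n. cis (2 * pi * of_nat i / of_nat m - 2 * pi * of_nat j / of_nat m) ^ pick K l)"
    using a b by (intro sum.cong refl) (simp only: entry lessThan_iff cis_power_mult_cnj)
  also have "\<dots> = (\<Sum>k\<in>K. cis (2 * pi * of_nat i / of_nat m - 2 * pi * of_nat j / of_nat m) ^ k)"
    by (rule sum.reindex_bij_betw[OF bK])
  finally show ?thesis
    by (simp add: poly_mask_poly diff_divide_distrib right_diff_distrib)
qed

section \<open>The period set determines the size\<close>

text \<open>The element 1 of a period set is the one that carries no orthogonality relation. Differences of
  distinct elements of \<open>{0..<m}\<close> never produce it.\<close>

lemma period_eq_1_iff:
  fixes m :: nat and d :: int
  assumes "m > 0"
  shows "int m div gcd (int m) d = 1 \<longleftrightarrow> int m dvd d"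
proof
  assume "int m div gcd (int m) d = 1"
  then have "gcd (int m) d = int m"
    by (metis dvd_mult_div_cancel gcd_dvd1 mult.right_neutral)
  then show "int m dvd d" by (metis gcd_dvd2)
next
  assume "int m dvd d"
  then show "int m div gcd (int m) d = 1" using assms by (simp add: gcd_proj1_if_dvd)
qed

text \<open>Rows from one Hadamard pair are combined with columns from the other. The period of a difference
  in \<open>J\<close> also occurs as the period of a difference in \<open>J'\<close>, so conjugacy carries
  the orthogonality relation of the second pair over to the mixed matrix.\<close>

lemma hadamard_pair_card_le_if_period_set_eq:
  assumes m: "m > 0" "m' > 0" and n': "n' > 0"
    and H: "hadamard_pair m n J K" and H': "hadamard_pair m' n' J' K'"
    and eq: "period_set m J = period_set m' J'"
  shows "n \<le> n'"
proof -
  have J: "J \<subseteq> {0..<m}" "card J = n" and K': "K' \<subseteq> {0..<m'}" "card K' = n'"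
    using H H' by (auto simp: hadamard_pair_def)
  have fin: "finite J" "finite K'" using J K' finite_subset by blast+
  have "K' \<noteq> {}" using K' n' by auto
  have "card J \<le> card K'"
  proof (rule card_orthogonal_unimodular_rows_le[OF fin \<open>K' \<noteq> {}\<close>,
        where v = "\<lambda>j k. cis (2 * pi * of_nat j / of_nat m) ^ k"])
    fix j k show "cmod (cis (2 * pi * of_nat j / of_nat m) ^ k) = 1"
      by (simp add: norm_power)
  next
    fix i j assume ij: "i \<in> J" "j \<in> J" "i \<noteq> j"
    let ?d = "int i - int j"
    have "int m div gcd (int m) ?d \<in> period_set m J"
      using ij by (auto simp: period_set_def diff_set_def)
    then have "int m div gcd (int m) ?d \<in> period_set m' J'" unfolding eq .
    then obtain i' j' where ij': "i' \<in> J'" "j' \<in> J'"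
      and per: "int m div gcd (int m) ?d = int m' div gcd (int m') (int i' - int j')"
      unfolding period_set_def diff_set_def by blast
    have "i < m" "j < m" using ij J by auto
    then have "\<not> int m dvd ?d" using ij(3) dvd_imp_le_int[of ?d "int m"] by auto
    then have "i' \<noteq> j'" using per period_eq_1_iff m by fastforce
    then have "ipoly (mask_poly K') (cis (2 * pi * of_int ?d / of_nat m)) = 0"
      using roots_of_unity_same_order_conjugate[OF m per]
        hadamard_pair_mask_poly_eq_0[OF H' ij'] by blast
    then show "(\<Sum>k\<in>K'. cis (2 * pi * of_nat i / of_nat m) ^ k
        * cnj (cis (2 * pi * of_nat j / of_nat m) ^ k)) = 0"
      unfolding cis_power_mult_cnj
      by (simp add: poly_mask_poly diff_divide_distrib right_diff_distrib)
  qed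
  then show ?thesis using J K' by simp
qed

theorem theorem2p13:
  fixes n n' m m' :: nat
  assumes "n > 0" and "n' > 0" and "n \<noteq> n'" and "m > 0" and "m' > 0"
  shows "vertices (compat_graph m n) \<inter> vertices (compat_graph m' n') = {}"
proof (rule ccontr)
  assume "\<not> ?thesis"
  then obtain J K J' K' where H: "hadamard_pair m n J K" "hadamard_pair m' n' J' K'"
    and eq: "period_set m J = period_set m' J'"
    by (auto simp: compat_graph_def)
  have "n \<le> n'" "n' \<le> n"
    using hadamard_pair_card_le_if_period_set_eq[OF _ _ _ H eq]
      hadamard_pair_card_le_if_period_set_eq[OF _ _ _ H(2,1) eq[symmetric]] assms by auto
  then show False using assms by simp
qed

end
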